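(* Let $\psi:\mathbb{R}\to\mathbb{R}$ be a continuously differentiable, $1$-periodic and anti-symmetric function, i.e. $\psi(x+1)=\psi(x)$ and $\psi(-x)=-\psi(x)$ for all $x$. Let $I(V,\sigma)$ denote the response current of $\psi$ at applied voltage $V\in\mathbb{R}$ and temperature $\sigma>0$. Then the resistance at zero voltage as a function of temperature, $\sigma\mapsto\left(\frac{\partial I}{\partial V}(0,\sigma)\right)^{-1}$, $\sigma>0$, determines the distribution of $\psi$. That is: if $\psi_1,\psi_2$ are two such functions, with response currents $I_1,I_2$, and $$\left(\frac{\partial I_1}{\partial V}(0,\sigma)\right)^{-1}=\left(\frac{\partial I_2}{\partial V}(0,\sigma)\right)^{-1}\quad\text{for all }\sigma>0,$$ then $\psi_1$ and $\psi_2$ have the same distribution.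
   Context: Response current: for a $1$-periodic function $\psi$, $V\in\mathbb{R}$ and $\sigma>0$, $I(V,\sigma)$ is the unique constant $I\in\mathbb{R}$ for which there is a $1$-periodic $C^1$ function $\overline{\rho}:\mathbb{R}\to\mathbb{R}$ satisfying $$\sigma\,\overline{\rho}_z+\psi_z\,\overline{\rho}+V\,\overline{\rho}=I \quad\text{on }\mathbb{R},\qquad \int_0^1\overline{\rho}(z)\,dz=1 .$$ (Equivalently, $\overline\rho$ is the normalized stationary $1$-periodic solution of $\rho_t=(\sigma\rho_z+\psi_z\rho+V\rho)_z$ and $I$ is its constant current.) Distribution of $\psi$: the push-forward of Lebesgue measure on $[0,1]$ under $\psi$, i.e. the probability measure $A\mapsto \mathrm{Leb}\{x\in[0,1]:\psi(x)\in A\}$ on Borel sets $A\subset\mathbb{R}$. *)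

theory Defs
  imports "HOL-Analysis.Analysis"
begin

definition periodic1 :: "(real \<Rightarrow> real) \<Rightarrow> bool" where
  "periodic1 f \<longleftrightarrow> (\<forall>x. f (x + 1) = f x)"

definition antisymmetric :: "(real \<Rightarrow> real) \<Rightarrow> bool" where
  "antisymmetric f \<longleftrightarrow> (\<forall>x. f (- x) = - f x)"

text \<open>\<open>\<rho>\<close> is a normalized stationary solution, with constant current \<open>I\<close>, of
  \<open>\<rho>\<^sub>t = (\<sigma> \<rho>\<^sub>z + \<psi>\<^sub>z \<rho> + V \<rho>)\<^sub>z\<close>. No sign condition is imposed on \<open>\<rho>\<close>.\<close>

definition stationary_solution ::
  "(real \<Rightarrow> real) \<Rightarrow> real \<Rightarrow> real \<Rightarrow> real \<Rightarrow> (real \<Rightarrow> real) \<Rightarrow> bool" where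
  "stationary_solution \<psi> V \<sigma> I \<rho> \<longleftrightarrow>
     periodic1 \<rho> \<and> \<rho> C1_differentiable_on UNIV \<and>
     (\<forall>z. \<sigma> * deriv \<rho> z + deriv \<psi> z * \<rho> z + V * \<rho> z = I) \<and>
     integral {0..1} \<rho> = 1"

text \<open>For \<open>\<sigma> > 0\<close> and \<open>\<psi>\<close> 1-periodic and continuously differentiable, there is exactly one
  such \<open>I\<close>; only in that case is the value meaningful.\<close>

definition response_current :: "(real \<Rightarrow> real) \<Rightarrow> real \<Rightarrow> real \<Rightarrow> real" where
  "response_current \<psi> V \<sigma> = (THE I. \<exists>\<rho>. stationary_solution \<psi> V \<sigma> I \<rho>)"

definition zero_voltage_resistance :: "(real \<Rightarrow> real) \<Rightarrow> real \<Rightarrow> real" where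
  "zero_voltage_resistance \<psi> \<sigma> = inverse (deriv (\<lambda>V. response_current \<psi> V \<sigma>) 0)"

definition distribution :: "(real \<Rightarrow> real) \<Rightarrow> real measure" where
  "distribution \<psi> = distr (lebesgue_on {0..1}) borel \<psi>"

end

theory Submission
  imports Defs "HOL-Probability.Probability"
begin

text \<open>Multiplying the stationary equation by the integrating factor \<open>g z = exp ((\<psi> z + V z) / \<sigma>)\<close> and
  integrating over one period gives \<open>\<rho> z (exp (V / \<sigma>) - 1) = (I / \<sigma>) r z\<close>, where \<open>r z\<close> is the integral
  of \<open>g\<close> over \<open>[z, z + 1]\<close> divided by \<open>g z\<close>. Hence \<open>I = \<sigma> (exp (V / \<sigma>) - 1) / N V\<close> with
  \<open>N V\<close> the integral of \<open>r\<close> over \<open>[0, 1]\<close>, and the resistance at zero voltage is \<open>N 0\<close>, the product of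
  the integrals of \<open>exp (\<psi> / \<sigma>)\<close> and \<open>exp (- \<psi> / \<sigma>)\<close>. By antisymmetry these integrals coincide,
  so the resistance determines the integrals of \<open>exp (n \<psi>)\<close>, taking \<open>\<sigma> = 1 / n\<close>. By Weierstrass
  approximation in the variable \<open>exp \<psi>\<close> these determine the characteristic function of
  the distribution.\<close>

section \<open>The response current\<close>

lemma C1_differentiable_on_deriv:
  fixes f :: "real \<Rightarrow> real"
  assumes "f C1_differentiable_on UNIV"
  shows "(f has_real_derivative deriv f x) (at x)" and "continuous_on UNIV (deriv f)"
proof -
  obtain D where D: "\<And>x. (f has_real_derivative D x) (at x)" "continuous_on UNIV D"
    using assms by (auto simp: C1_differentiable_on_def has_real_derivative_iff_has_vector_derivative)
  have "deriv f = D"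
    using D(1) by (auto intro: DERIV_imp_deriv)
  with D show "(f has_real_derivative deriv f x) (at x)" and "continuous_on UNIV (deriv f)"
    by auto
qed

lemma integral_pos:
  fixes f :: "real \<Rightarrow> real"
  assumes f: "continuous_on {a..b} f" and ab: "a < b" and pos: "\<And>x. x \<in> {a..b} \<Longrightarrow> f x > 0"
  shows "integral {a..b} f > 0"
proof -
  have "integral {a..b} f \<ge> 0"
    by (intro integral_nonneg integrable_continuous_real f) (auto simp: less_imp_le pos)
  moreover have "integral {a..b} f \<noteq> 0"
    using integral_eq_0_iff [OF f ab] pos [of a] pos ab by (fastforce simp: less_imp_le)
  ultimately show ?thesis
    by simp
qed

locale periodic_potential =
  fixes \<psi> :: "real \<Rightarrow> real" and \<sigma> :: real
  assumes C1: "\<psi> C1_differentiable_on UNIV"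
    and periodic: "periodic1 \<psi>"
    and \<sigma>_pos: "\<sigma> > 0"
begin

text \<open>The integrating factor g of the overview; \<open>profile\<close> is r and
  \<open>mass\<close> is N.\<close>

definition weight :: "real \<Rightarrow> real \<Rightarrow> real" where
  "weight V z = exp ((\<psi> z + V * z) / \<sigma>)"

text \<open>Unnormalized stationary density. Solving for \<rho> would divide by
  \<open>exp (V / \<sigma>) - 1\<close>; this form avoids that and stays valid at V = 0.\<close>

definition profile :: "real \<Rightarrow> real \<Rightarrow> real" where
  "profile V z = integral {z..z + 1} (weight V) / weight V z"

definition mass :: "real \<Rightarrow> real" where
  "mass V = integral {0..1} (profile V)"

lemma weight_pos [simp]: "weight V z > 0"
  by (simp add: weight_def)

lemma weight_nonzero [simp]: "weight V z \<noteq> 0"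
  by (simp add: weight_def)

lemma weight_shift: "weight V (z + 1) = exp (V / \<sigma>) * weight V z"
proof -
  have "\<psi> (z + 1) = \<psi> z"
    using periodic by (simp add: periodic1_def)
  then show ?thesis
    by (simp add: weight_def add_divide_distrib distrib_left flip: exp_add)
qed

text \<open>Isolates the voltage in a factor depending only on y - z, which makes the later bounds
  uniform in z.\<close>

lemma weight_tilt: "weight V y / weight V z = exp (V * (y - z) / \<sigma>) * (weight 0 y / weight 0 z)"
  by (simp add: weight_def flip: exp_diff exp_add)
     (simp add: diff_divide_distrib [symmetric] add_divide_distrib [symmetric] algebra_simps)

lemma has_derivative_weight:
  "(weight V has_real_derivative (deriv \<psi> z + V) / \<sigma> * weight V z) (at z)"
  unfolding weight_def
  using \<sigma>_pos by (auto intro!: derivative_eq_intros C1_differentiable_on_deriv(1) [OF C1])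

lemma continuous_weight: "continuous_on S (weight V)"
  by (meson DERIV_isCont continuous_at_imp_continuous_on has_derivative_weight)

lemma weight_integrable [simp]: "weight V integrable_on {a..b}"
  by (rule integrable_continuous_real [OF continuous_weight])

lemma integral_weight_pos: "integral {z..z + 1} (weight V) > 0"
  by (intro integral_pos continuous_weight) auto

lemma has_derivative_integral_weight:
  "((\<lambda>z. integral {z..z + 1} (weight V)) has_real_derivative (exp (V / \<sigma>) - 1) * weight V z) (at z)"
proof -
  have "isCont (weight V) x" for x
    using has_derivative_weight DERIV_isCont by blast
  \<comment> \<open>A primitive on the whole line, since both endpoints of the interval move with
    z.\<close>
  then obtain F where F: "\<And>x. (F has_real_derivative weight V x) (at x)"
    using einterval_antiderivative [of "-\<infinity>" "\<infinity>" "weight V"]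
    by (auto simp: has_real_derivative_iff_has_vector_derivative)
  have "integral {z..z + 1} (weight V) = F (z + 1) - F z" for z
    using F by (intro integral_unique fundamental_theorem_of_calculus)
      (auto simp: has_real_derivative_iff_has_vector_derivative intro: has_vector_derivative_at_within)
  moreover have "((\<lambda>z. F (z + 1) - F z) has_real_derivative weight V (z + 1) - weight V z) (at z)"
    by (intro DERIV_diff F) (simp add: F flip: DERIV_shift)
  ultimately show ?thesis
    unfolding weight_shift by (simp add: left_diff_distrib)
qed

lemma profile_pos: "profile V z > 0"
  by (simp add: profile_def integral_weight_pos)

text \<open>After multiplication by \<sigma> this is the stationary equation with current
  \<open>\<sigma> * (exp (V / \<sigma>) - 1)\<close>.\<close>

lemma has_derivative_profile:
  "(profile V has_real_derivative exp (V / \<sigma>) - 1 - (deriv \<psi> z + V) / \<sigma> * profile V z) (at z)"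
  unfolding profile_def [abs_def]
  using DERIV_divide [OF has_derivative_integral_weight has_derivative_weight weight_nonzero]
  by (rule DERIV_cong) (simp add: diff_divide_distrib)

lemma continuous_profile: "continuous_on S (profile V)"
  by (meson DERIV_isCont continuous_at_imp_continuous_on has_derivative_profile)

lemma profile_integrable [simp]: "profile V integrable_on {a..b}"
  by (rule integrable_continuous_real [OF continuous_profile])

text \<open>Numerator and denominator both gain the factor \<open>exp (V / \<sigma>)\<close>, which
  cancels.\<close>

lemma profile_periodic: "profile V (z + 1) = profile V z"
proof -
  have "integral {z + 1..z + 1 + 1} (weight V) = integral {z..z + 1} (\<lambda>x. weight V (x + 1))"
    using integral_shift_Icc_real [of z "z + 1" "weight V" 1] by (simp add: o_def add.commute)
  then show ?thesis
    by (simp add: profile_def weight_shift)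
qed

lemma mass_pos: "mass V > 0"
  unfolding mass_def by (intro integral_pos continuous_profile profile_pos) auto

lemma stationary_profile:
  "stationary_solution \<psi> V \<sigma> (\<sigma> * (exp (V / \<sigma>) - 1) / mass V) (\<lambda>z. profile V z / mass V)"
proof -
  have d: "((\<lambda>z. profile V z / mass V) has_real_derivative
      (exp (V / \<sigma>) - 1 - (deriv \<psi> z + V) / \<sigma> * profile V z) / mass V) (at z)" for z
    by (intro DERIV_cdivide has_derivative_profile)
  have "(\<lambda>z. profile V z / mass V) C1_differentiable_on UNIV"
    unfolding C1_differentiable_on_def
  proof (intro exI conjI ballI)
    show "continuous_on UNIV (\<lambda>z. (exp (V / \<sigma>) - 1 - (deriv \<psi> z + V) / \<sigma> * profile V z) / mass V)"
      using \<sigma>_pos mass_pos [of V]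
      by (intro continuous_intros continuous_profile C1_differentiable_on_deriv(2) [OF C1]) auto
  qed (rule d [unfolded has_real_derivative_iff_has_vector_derivative])
  moreover have "\<sigma> * deriv (\<lambda>z. profile V z / mass V) z + deriv \<psi> z * (profile V z / mass V)
      + V * (profile V z / mass V) = \<sigma> * (exp (V / \<sigma>) - 1) / mass V" for z
    using \<sigma>_pos mass_pos [of V] by (simp add: DERIV_imp_deriv [OF d] field_simps)
  moreover have "integral {0..1} (\<lambda>z. profile V z / mass V) = 1"
    using mass_pos [of V] by (simp add: mass_def)
  ultimately show ?thesis
    by (simp add: stationary_solution_def periodic1_def profile_periodic)
qed

text \<open>Uniqueness of the current. The only divisions are by quantities that are positive for
  every V, so V = 0 needs no separate case.\<close>

lemma stationary_current_eq:
  assumes "stationary_solution \<psi> V \<sigma> I \<rho>"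
  shows "I = \<sigma> * (exp (V / \<sigma>) - 1) / mass V"
proof -
  have per: "\<rho> (z + 1) = \<rho> z"
    and ode: "\<sigma> * deriv \<rho> z + deriv \<psi> z * \<rho> z + V * \<rho> z = I" for z
    using assms by (auto simp: stationary_solution_def periodic1_def)
  have d\<rho>: "(\<rho> has_real_derivative deriv \<rho> z) (at z)" for z
    using assms by (auto simp: stationary_solution_def intro: C1_differentiable_on_deriv(1))
  have d: "((\<lambda>z. \<rho> z * weight V z) has_real_derivative (I / \<sigma>) * weight V z) (at z)" for z
    using \<sigma>_pos
    by (auto intro!: derivative_eq_intros d\<rho> has_derivative_weight simp: ode [of z, symmetric] field_simps)
  have "(exp (V / \<sigma>) - 1) * \<rho> z = (I / \<sigma>) * profile V z" for z
  proof -
    have "((\<lambda>x. (I / \<sigma>) * weight V x) has_integral \<rho> (z + 1) * weight V (z + 1) - \<rho> z * weight V z) {z..z + 1}"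
      using d by (intro fundamental_theorem_of_calculus)
        (auto simp: has_real_derivative_iff_has_vector_derivative intro: has_vector_derivative_at_within)
    then have "(I / \<sigma>) * integral {z..z + 1} (weight V) = (exp (V / \<sigma>) - 1) * \<rho> z * weight V z"
      by (simp only: per weight_shift integral_mult_right [symmetric] integral_unique)
         (simp add: algebra_simps)
    then show ?thesis
      unfolding profile_def times_divide_eq_right by (subst nonzero_eq_divide_eq) simp_all
  qed
  \<comment> \<open>Averaging over a period eliminates \<rho> through its normalization.\<close>
  then have "integral {0..1} (\<lambda>z. (exp (V / \<sigma>) - 1) * \<rho> z) = integral {0..1} (\<lambda>z. (I / \<sigma>) * profile V z)"
    by simp
  then have "exp (V / \<sigma>) - 1 = (I / \<sigma>) * mass V"
    using assms by (simp add: stationary_solution_def mass_def)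
  then show ?thesis
    using \<sigma>_pos mass_pos [of V] by (simp add: field_simps)
qed

lemma response_current_eq: "response_current \<psi> V \<sigma> = \<sigma> * (exp (V / \<sigma>) - 1) / mass V"
  unfolding response_current_def
  using stationary_profile stationary_current_eq by (intro the_equality) blast+

section \<open>The resistance at zero voltage\<close>

text \<open>On the window of integration 0 \<le> y - z \<le> 1, so by \<open>weight_tilt\<close> the
  voltage changes the integrand by a factor between \<open>exp (- \<bar>V\<bar> / \<sigma>)\<close>
  and \<open>exp (\<bar>V\<bar> / \<sigma>)\<close>.\<close>

lemma profile_tilt_bounds:
  "exp (- \<bar>V\<bar> / \<sigma>) * profile 0 z \<le> profile V z" "profile V z \<le> exp (\<bar>V\<bar> / \<sigma>) * profile 0 z"
proof -
  have has_int: "((\<lambda>y. weight U y / weight U z) has_integral profile U z) {z..z + 1}" for U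
    unfolding profile_def by (intro has_integral_divide integrable_integral weight_integrable)
  have bd: "exp (- \<bar>V\<bar> / \<sigma>) * (weight 0 y / weight 0 z) \<le> weight V y / weight V z"
    "weight V y / weight V z \<le> exp (\<bar>V\<bar> / \<sigma>) * (weight 0 y / weight 0 z)"
    if "y \<in> {z..z + 1}" for y
  proof -
    have "\<bar>V * (y - z)\<bar> \<le> \<bar>V\<bar> * 1"
      unfolding abs_mult using that by (intro mult_left_mono) auto
    then have "- \<bar>V\<bar> / \<sigma> \<le> V * (y - z) / \<sigma>" "V * (y - z) / \<sigma> \<le> \<bar>V\<bar> / \<sigma>"
      using \<sigma>_pos by (intro divide_right_mono; linarith)+
    then show "exp (- \<bar>V\<bar> / \<sigma>) * (weight 0 y / weight 0 z) \<le> weight V y / weight V z"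
      "weight V y / weight V z \<le> exp (\<bar>V\<bar> / \<sigma>) * (weight 0 y / weight 0 z)"
      unfolding weight_tilt [of V]
      by (intro mult_right_mono; simp add: less_imp_le)+
  qed
  show "exp (- \<bar>V\<bar> / \<sigma>) * profile 0 z \<le> profile V z"
    by (rule has_integral_le [OF has_integral_mult_right [OF has_int] has_int bd(1)])
  show "profile V z \<le> exp (\<bar>V\<bar> / \<sigma>) * profile 0 z"
    by (rule has_integral_le [OF has_int has_integral_mult_right [OF has_int] bd(2)])
qed

lemma mass_tendsto: "(mass \<longlongrightarrow> mass 0) (at 0)"
proof (rule tendsto_sandwich)
  have "exp (- \<bar>V\<bar> / \<sigma>) * mass 0 \<le> mass V" "mass V \<le> exp (\<bar>V\<bar> / \<sigma>) * mass 0" for V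
    unfolding mass_def integral_mult_right [symmetric]
    by (intro integral_le profile_tilt_bounds integrable_on_mult_right profile_integrable)+
  then show "\<forall>\<^sub>F V in at 0. exp (- \<bar>V\<bar> / \<sigma>) * mass 0 \<le> mass V"
    and "\<forall>\<^sub>F V in at 0. mass V \<le> exp (\<bar>V\<bar> / \<sigma>) * mass 0"
    by auto
  have "((\<lambda>V. exp (- \<bar>V\<bar> / \<sigma>) * mass 0) \<longlongrightarrow> exp (- \<bar>0\<bar> / \<sigma>) * mass 0) (at 0)"
    using \<sigma>_pos by (intro tendsto_intros) auto
  then show "((\<lambda>V. exp (- \<bar>V\<bar> / \<sigma>) * mass 0) \<longlongrightarrow> mass 0) (at 0)"
    by simp
  have "((\<lambda>V. exp (\<bar>V\<bar> / \<sigma>) * mass 0) \<longlongrightarrow> exp (\<bar>0\<bar> / \<sigma>) * mass 0) (at 0)"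
    using \<sigma>_pos by (intro tendsto_intros) auto
  then show "((\<lambda>V. exp (\<bar>V\<bar> / \<sigma>) * mass 0) \<longlongrightarrow> mass 0) (at 0)"
    by simp
qed

text \<open>The current vanishes at V = 0, so its difference quotient there is a quotient tending to
  1 divided by \<open>mass V\<close>; continuity of \<open>mass\<close> at 0 then suffices.\<close>

lemma zero_voltage_resistance_eq_mass: "zero_voltage_resistance \<psi> \<sigma> = mass 0"
proof -
  have "((\<lambda>V. \<sigma> * (exp (V / \<sigma>) - 1)) has_real_derivative 1) (at 0)"
    using \<sigma>_pos by (auto intro!: derivative_eq_intros)
  then have "((\<lambda>V. (\<sigma> * (exp (V / \<sigma>) - 1) / V) / mass V) \<longlongrightarrow> 1 / mass 0) (at 0)"
    using mass_pos [of 0] by (intro tendsto_divide mass_tendsto) (auto simp: DERIV_def)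
  then have "((\<lambda>V. response_current \<psi> V \<sigma>) has_real_derivative 1 / mass 0) (at 0)"
    by (simp add: DERIV_def response_current_eq field_simps)
  then show ?thesis
    by (simp add: zero_voltage_resistance_def DERIV_imp_deriv)
qed

text \<open>At V = 0 the derivative of the window integral has the factor
  \<open>exp 0 - 1 = 0\<close>.\<close>

lemma integral_weight_0: "integral {z..z + 1} (weight 0) = integral {0..1} (weight 0)"
  using DERIV_isconst_all [of "\<lambda>z. integral {z..z + 1} (weight 0)" z 0]
    has_derivative_integral_weight [of 0] by simp

text \<open>The numerator of \<open>profile 0\<close> is constant in z, so the double integral
  factors.\<close>

lemma mass_0:
  "mass 0 = integral {0..1} (\<lambda>z. exp (\<psi> z / \<sigma>)) * integral {0..1} (\<lambda>z. exp (- \<psi> z / \<sigma>))"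
proof -
  have "profile 0 = (\<lambda>z. integral {0..1} (\<lambda>z. exp (\<psi> z / \<sigma>)) * exp (- \<psi> z / \<sigma>))"
    using integral_weight_0
    by (auto simp: profile_def weight_def [abs_def] exp_minus field_simps)
  then show ?thesis
    by (simp add: mass_def)
qed

theorem zero_voltage_resistance_antisymmetric:
  assumes "antisymmetric \<psi>"
  shows "zero_voltage_resistance \<psi> \<sigma> = (integral {0..1} (\<lambda>z. exp (\<psi> z / \<sigma>)))\<^sup>2"
proof -
  have "integral {0..1} (\<lambda>z. exp (- \<psi> z / \<sigma>)) = integral {0..1} (\<lambda>z. weight 0 (- z))"
    using assms by (simp add: weight_def antisymmetric_def)
  \<comment> \<open>Reflection maps the unit interval to another full period; its right end is
    written -1 + 1 to match \<open>integral_weight_0\<close>.\<close>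
  also have "\<dots> = integral {-1..-1 + 1} (weight 0)"
    using Henstock_Kurzweil_Integration.integral_reflect_real [of 0 "- 1" "weight 0"] by simp
  also have "\<dots> = integral {0..1} (\<lambda>z. exp (\<psi> z / \<sigma>))"
    by (simp only: integral_weight_0) (simp add: weight_def [abs_def])
  finally show ?thesis
    by (simp add: zero_voltage_resistance_eq_mass mass_0 power2_eq_square)
qed

end

section \<open>Exponential integrals determine the distribution\<close>

text \<open>A moment problem on a compact set: equal moments of \<open>exp f\<close> and
  \<open>exp g\<close> give equal integrals of polynomials, then of continuous test functions, and
  cosine and sine yield the characteristic function.\<close>

lemma distribution_eqI:
  fixes f g :: "real \<Rightarrow> real"
  assumes f: "continuous_on {0..1} f" and g: "continuous_on {0..1} g"
    and eq: "\<And>n::nat. integral {0..1} (\<lambda>z. exp (f z) ^ n) = integral {0..1} (\<lambda>z. exp (g z) ^ n)"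
  shows "distribution f = distribution g"
proof -
  \<comment> \<open>K contains both ranges, so one polynomial serves f and g; it lies in the
    positive reals, where \<open>ln\<close> is continuous.\<close>
  define K where "K = exp ` (f ` {0..1} \<union> g ` {0..1})"
  have K: "compact K"
    unfolding K_def using f g by (intro compact_continuous_image compact_Un continuous_intros) auto
  have K_in: "exp (f z) \<in> K" "exp (g z) \<in> K" if "z \<in> {0..1}" for z
    using that by (auto simp: K_def)
  have poly: "integral {0..1} (\<lambda>z. p (exp (f z))) = integral {0..1} (\<lambda>z. p (exp (g z)))"
    if p: "real_polynomial_function p" for p
  proof -
    obtain a n where "p = (\<lambda>x. \<Sum>i\<le>n. a i * x ^ i)"
      using p by (auto simp: real_polynomial_function_iff_sum)
    moreover have "integral {0..1} (\<lambda>z. \<Sum>i\<le>n. a i * exp (h z) ^ i)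
        = (\<Sum>i\<le>n. a i * integral {0..1} (\<lambda>z. exp (h z) ^ i))"
      if "continuous_on {0..1} h" for h :: "real \<Rightarrow> real"
      using that by (subst integral_sum)
        (auto intro!: integrable_continuous_real continuous_intros)
    ultimately show ?thesis
      using f g eq by simp
  qed
  have test: "integral {0..1} (\<lambda>z. \<phi> (f z)) = integral {0..1} (\<lambda>z. \<phi> (g z))"
    if \<phi>: "continuous_on UNIV \<phi>" for \<phi> :: "real \<Rightarrow> real"
  proof (rule ccontr)
    let ?I = "\<lambda>h::real \<Rightarrow> real. integral {0..1} h"
    assume "?I (\<lambda>z. \<phi> (f z)) \<noteq> ?I (\<lambda>z. \<phi> (g z))"
    \<comment> \<open>Half the supposed gap: two approximation errors below it cannot add up to the
      gap.\<close>
    then have e: "0 < \<bar>?I (\<lambda>z. \<phi> (f z)) - ?I (\<lambda>z. \<phi> (g z))\<bar> / 2" (is "0 < ?e")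
      by simp
    have "continuous_on K (\<lambda>x. \<phi> (ln x))"
      by (rule continuous_on_compose2 [OF \<phi>]) (auto intro!: continuous_intros simp: K_def)
    then obtain p where p: "real_polynomial_function p" "\<And>x. x \<in> K \<Longrightarrow> \<bar>\<phi> (ln x) - p x\<bar> < ?e"
      using Stone_Weierstrass_real_polynomial_function [OF K _ e] by blast
    have pc: "continuous_on S p" for S
      using p(1) by (simp add: continuous_on_polymonial_function real_polynomial_function_eq)
    have approx: "\<bar>?I (\<lambda>z. \<phi> (h z)) - ?I (\<lambda>z. p (exp (h z)))\<bar> < ?e"
      if h: "continuous_on {0..1} h" and hK: "\<And>z. z \<in> {0..1} \<Longrightarrow> exp (h z) \<in> K" for h
    proof -
      have c1: "continuous_on {0..1} (\<lambda>z. \<phi> (h z))"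
        by (rule continuous_on_compose2 [OF \<phi> h]) auto
      have c2: "continuous_on {0..1} (\<lambda>z. p (exp (h z)))"
        by (rule continuous_on_compose2 [OF pc [of UNIV]]) (auto intro!: continuous_intros h)
      have c: "continuous_on {0..1} (\<lambda>z. \<bar>\<phi> (h z) - p (exp (h z))\<bar>)"
        by (intro continuous_intros c1 c2)
      \<comment> \<open>The integral bound is not strict; bounding by the attained maximum keeps the
        error strictly below \<open>?e\<close>.\<close>
      obtain m where m: "m \<in> {0..1}"
          "\<And>z. z \<in> {0..1} \<Longrightarrow> \<bar>\<phi> (h z) - p (exp (h z))\<bar> \<le> \<bar>\<phi> (h m) - p (exp (h m))\<bar>"
        using continuous_attains_sup [OF _ _ c] by auto
      have "norm (?I (\<lambda>z. \<phi> (h z) - p (exp (h z)))) \<le> \<bar>\<phi> (h m) - p (exp (h m))\<bar> * (1 - 0)"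
        using m by (intro integral_bound continuous_intros c1 c2) auto
      also have "\<dots> < ?e"
        using p(2) [OF hK [OF m(1)]] by simp
      finally show ?thesis
        using c1 c2 by (simp add: integral_diff integrable_continuous_real)
    qed
    show False
      using approx [OF f] approx [OF g] K_in poly [OF p(1)]
      by (smt (verit) field_sum_of_halves)
  qed
  have meas: "h \<in> borel_measurable (lebesgue_on {0..1})" if "continuous_on {0..1} h" for h :: "real \<Rightarrow> real"
    using that by (intro continuous_imp_measurable_on_sets_lebesgue) auto
  have rd: "real_distribution (distribution h)" if "continuous_on {0..1} h" for h
  proof -
    have "prob_space (lebesgue_on {0..1::real})"
      by (rule prob_spaceI) (simp add: emeasure_restrict_space)
    then interpret prob_space "lebesgue_on {0..1::real}" .
    show ?thesis
      unfolding distribution_def by (rule real_distribution_distr [OF meas [OF that]])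
  qed
  \<comment> \<open>Real and imaginary parts are integrals of real test functions, to which
    \<open>test\<close> applies.\<close>
  have char: "char (distribution h) t
      = Complex (integral {0..1} (\<lambda>z. cos (t * h z))) (integral {0..1} (\<lambda>z. sin (t * h z)))"
    if h: "continuous_on {0..1} h" for h t
  proof -
    have c: "continuous_on {0..1} (\<lambda>z. iexp (t * h z))"
      using h by (intro continuous_intros)
    then have i: "integrable (lebesgue_on {0..1}) (\<lambda>z. iexp (t * h z))"
      by (rule continuous_imp_integrable_real)
    have "char (distribution h) t = integral\<^sup>L (lebesgue_on {0..1}) (\<lambda>z. iexp (t * h z))"
      unfolding char_def distribution_def using meas [OF h] by (subst integral_distr) auto
    moreover have "Re (integral\<^sup>L (lebesgue_on {0..1}) (\<lambda>z. iexp (t * h z)))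
        = integral {0..1} (\<lambda>z. cos (t * h z))"
      using h by (subst integral_Re [OF i, symmetric])
        (auto simp: Re_exp intro!: lebesgue_integral_eq_integral continuous_imp_integrable_real continuous_intros)
    moreover have "Im (integral\<^sup>L (lebesgue_on {0..1}) (\<lambda>z. iexp (t * h z)))
        = integral {0..1} (\<lambda>z. sin (t * h z))"
      using h by (subst integral_Im [OF i, symmetric])
        (auto simp: Im_exp intro!: lebesgue_integral_eq_integral continuous_imp_integrable_real continuous_intros)
    ultimately show ?thesis
      by (simp add: complex_eq_iff)
  qed
  have "char (distribution f) t = char (distribution g) t" for t
    using test [of "\<lambda>x. cos (t * x)"] test [of "\<lambda>x. sin (t * x)"]
    by (simp add: char f g continuous_intros)
  then have "char (distribution f) = char (distribution g)"
    by (rule ext)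
  then show ?thesis
    by (rule Levy_uniqueness [OF rd [OF f] rd [OF g]])
qed

theorem proposition2p1:
  fixes \<psi>\<^sub>1 \<psi>\<^sub>2 :: "real \<Rightarrow> real"
  assumes "\<psi>\<^sub>1 C1_differentiable_on UNIV" and "periodic1 \<psi>\<^sub>1" and "antisymmetric \<psi>\<^sub>1"
    and "\<psi>\<^sub>2 C1_differentiable_on UNIV" and "periodic1 \<psi>\<^sub>2" and "antisymmetric \<psi>\<^sub>2"
    and "\<And>\<sigma>. \<sigma> > 0 \<Longrightarrow> zero_voltage_resistance \<psi>\<^sub>1 \<sigma> = zero_voltage_resistance \<psi>\<^sub>2 \<sigma>"
  shows "distribution \<psi>\<^sub>1 = distribution \<psi>\<^sub>2"
proof (rule distribution_eqI)
  show "continuous_on {0..1} \<psi>\<^sub>1" "continuous_on {0..1} \<psi>\<^sub>2"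
    using assms(1,4) by (meson C1_differentiable_imp_continuous_on continuous_on_subset subset_UNIV)+
  fix n :: nat
  show "integral {0..1} (\<lambda>z. exp (\<psi>\<^sub>1 z) ^ n) = integral {0..1} (\<lambda>z. exp (\<psi>\<^sub>2 z) ^ n)"
  \<comment> \<open>The zeroth moment corresponds to no temperature, but both sides are then the
    integral of 1.\<close>
  proof (cases "n = 0")
    case False
    define \<sigma> where "\<sigma> = inverse (real n)"
    have \<sigma>: "\<sigma> > 0"
      using False by (simp add: \<sigma>_def)
    interpret p1: periodic_potential \<psi>\<^sub>1 \<sigma>
      using assms \<sigma> by unfold_locales
    interpret p2: periodic_potential \<psi>\<^sub>2 \<sigma>
      using assms \<sigma> by unfold_locales
    have "(integral {0..1} (\<lambda>z. exp (\<psi>\<^sub>1 z / \<sigma>)))\<^sup>2 = (integral {0..1} (\<lambda>z. exp (\<psi>\<^sub>2 z / \<sigma>)))\<^sup>2"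
      using assms(7) [OF \<sigma>] assms(3,6)
      by (simp add: p1.zero_voltage_resistance_antisymmetric p2.zero_voltage_resistance_antisymmetric)
    \<comment> \<open>Nonnegativity allows the squares to be removed.\<close>
    moreover have "integral {0..1} (\<lambda>z. exp (\<psi>\<^sub>1 z / \<sigma>)) \<ge> 0" "integral {0..1} (\<lambda>z. exp (\<psi>\<^sub>2 z / \<sigma>)) \<ge> 0"
      using p1.weight_integrable [of 0 0 1] p2.weight_integrable [of 0 0 1]
      by (auto intro!: integral_nonneg simp: p1.weight_def [abs_def] p2.weight_def [abs_def])
    ultimately have "integral {0..1} (\<lambda>z. exp (\<psi>\<^sub>1 z / \<sigma>)) = integral {0..1} (\<lambda>z. exp (\<psi>\<^sub>2 z / \<sigma>))"
      by (simp add: power2_eq_iff_nonneg)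
    then show ?thesis
      by (simp add: \<sigma>_def divide_inverse mult.commute [of _ "real n"] exp_of_nat_mult)
  qed simp
qed

end
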